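(* Let $a,b\in\mathbb{Z}$ with $a\neq 0$, let $d(x)=ax+b$ and $g(x)=1$, and let $(\mathcal{F}_n(x))_{n\ge 0}$ be the Fibonacci-type polynomial sequence determined by $d(x)$ and $g(x)$. If $p$ is a prime number, then $\mathcal{F}_p(x)$ is irreducible over $\mathbb{Q}$.
   Context: The Fibonacci-type polynomial sequence determined by $d(x),g(x)\in\mathbb{Z}[x]$ is defined by $\mathcal{F}_0(x)=0$, $\mathcal{F}_1(x)=1$, and $\mathcal{F}_n(x)=d(x)\mathcal{F}_{n-1}(x)+g(x)\mathcal{F}_{n-2}(x)$ for $n\ge 2$. *)

theory Defs
  imports "HOL-Computational_Algebra.Computational_Algebra"
begin

fun fibonacci_type_poly :: "int poly \<Rightarrow> int poly \<Rightarrow> nat \<Rightarrow> int poly" where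
  "fibonacci_type_poly d g 0 = 0"
| "fibonacci_type_poly d g (Suc 0) = 1"
| "fibonacci_type_poly d g (Suc (Suc n)) =
     d * fibonacci_type_poly d g (Suc n) + g * fibonacci_type_poly d g n"

end

theory Submission
  imports Defs "Berlekamp_Zassenhaus.Factor_Bound"
begin

text \<open>
  For \<open>p = 2 k + 1\<close> the polynomial \<open>F\<^sub>p\<close> is \<open>H (d\<^sup>2 + 4)\<close> with \<open>H\<close> monic of degree \<open>k\<close>, and the explicit
  coefficients of \<open>H\<close> show that it is an Eisenstein polynomial at \<open>p\<close>. A linear substitution
  reduces to \<open>d = x\<close>. Writing a root of \<open>F\<^sub>p\<close> as \<open>z = \<alpha> + \<beta>\<close> with \<open>\<alpha> \<beta> = -1\<close>, we get
  \<open>\<alpha>\<^sup>p = \<beta>\<^sup>p\<close>, so \<open>\<bar>\<alpha>\<bar> = \<bar>\<beta>\<bar> = 1\<close> and \<open>z\<close> is purely imaginary. Hence an irreducible rational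
  factor \<open>u\<close> of \<open>F\<^sub>p\<close> with root \<open>z\<close> also vanishes at the conjugate \<open>-z\<close>, so it shares \<open>z\<close> with \<open>u (-x)\<close>;
  as \<open>u (0) \<noteq> 0\<close>, it is even, that is, a polynomial in \<open>x\<^sup>2 + 4\<close>, and irreducibility of \<open>H\<close> carries
  over to \<open>F\<^sub>p\<close>.
\<close>

hide_const (open) up_ring.coeff up_ring.monom Module.smult

declare pcompose_pCons [simp del]

section \<open>Odd-index terms as polynomials in y = d^2 + 4\<close>

fun odd_fib_poly :: "nat \<Rightarrow> int poly" where
  "odd_fib_poly 0 = 1"
| "odd_fib_poly (Suc 0) = [:-3, 1:]"
| "odd_fib_poly (Suc (Suc k)) = [:-2, 1:] * odd_fib_poly (Suc k) - odd_fib_poly k"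

text \<open>Eliminating the even-index terms leaves F(n+4) = (d^2 + 2) F(n+2) - F(n), and d^2 + 2 =
  y - 2. Here y is the discriminant of t^2 - d t - 1; with roots \<alpha>, \<beta> and p an odd
  prime, F(p) = (\<alpha>^p - \<beta>^p) / (\<alpha> - \<beta>) is congruent to (\<alpha> -
  \<beta>)^(p-1) = y^((p-1)/2) modulo p, which is why the variable y suits Eisenstein's
  criterion.\<close>

lemma fibonacci_type_poly_odd:
  "fibonacci_type_poly d 1 (2 * k + 1) = odd_fib_poly k \<circ>\<^sub>p (d\<^sup>2 + [:4:])"
proof (induction k rule: odd_fib_poly.induct)
  case 1
  then show ?case by (simp add: pcompose_1)
next
  case 2
  have "fibonacci_type_poly d 1 (2 * Suc 0 + 1) = d\<^sup>2 + 1"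
    by (simp add: eval_nat_numeral)
  also have "\<dots> = [:-3:] + (d\<^sup>2 + [:4:])"
    by (simp add: poly_eq_iff coeff_pCons split: nat.splits)
  finally show ?case by (simp add: pcompose_pCons)
next
  case (3 k)
  let ?F = "fibonacci_type_poly d 1"
  have rec: "?F (Suc (Suc n)) = d * ?F (Suc n) + ?F n" for n by simp
  have "?F (Suc (Suc (Suc (Suc n)))) = (d\<^sup>2 + [:2:]) * ?F (Suc (Suc n)) - ?F n" for n
    unfolding rec by (simp add: algebra_simps power2_eq_square flip: numeral_poly)
  from this[of "2 * k + 1"]
  have "?F (2 * Suc (Suc k) + 1) = (d\<^sup>2 + [:2:]) * ?F (2 * Suc k + 1) - ?F (2 * k + 1)"
    by (simp only: mult_Suc_right add_Suc One_nat_def add_Suc_right add_0_left add_0_right numeral_2_eq_2)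
  moreover have "[:-2, 1:] \<circ>\<^sub>p (d\<^sup>2 + [:4:]) = d\<^sup>2 + [:2:]"
    by (simp add: pcompose_pCons)
  ultimately show ?case
    by (simp only: 3 odd_fib_poly.simps pcompose_diff pcompose_mult)
qed

text \<open>Pascal's rule applied twice: a second difference in the upper index lowers the lower
  index by 2.\<close>

lemma binomial_second_difference:
  "int (n + 2 choose (m + 2)) = 2 * int (n + 1 choose (m + 2)) + int (n choose m) - int (n choose (m + 2))"
  by (simp add: eval_nat_numeral)

text \<open>Once the sign is factored out, the recurrence becomes a second difference in
  \<open>k\<close>, which each of the two binomials satisfies separately.\<close>

lemma coeff_odd_fib_poly:
  "coeff (odd_fib_poly k) j =
     (-1) ^ (k + j) * int ((k + j choose (2 * j)) + 2 * (k + j choose (2 * j + 1)))"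
proof (induction k arbitrary: j rule: odd_fib_poly.induct)
  case 1
  then show ?case by (cases j) (auto simp: binomial_eq_0)
next
  case 2
  then show ?case
    by (cases j) (auto simp: coeff_pCons binomial_eq_0 eval_nat_numeral split: nat.splits)
next
  case (3 k)
  show ?case
  proof (cases j)
    case 0
    then show ?thesis by (simp add: 3) (simp add: algebra_simps)
  next
    case (Suc i)
    have even: "int (Suc (Suc k) + j choose (2 * j)) = 2 * int (Suc k + j choose (2 * j))
        + int (Suc k + i choose (2 * i)) - int (k + j choose (2 * j))"
      using binomial_second_difference[of "k + j" "2 * i"] Suc by simp
    have odd: "int (Suc (Suc k) + j choose (2 * j + 1)) = 2 * int (Suc k + j choose (2 * j + 1))
        + int (Suc k + i choose (2 * i + 1)) - int (k + j choose (2 * j + 1))"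
      using binomial_second_difference[of "k + j" "2 * i + 1"] Suc by simp
    have sgn: "(-1) ^ (Suc (Suc k) + j) = ((-1) ^ (k + j) :: int)"
      "(-1) ^ (Suc k + j) = (- ((-1) ^ (k + j)) :: int)"
      "(-1) ^ (Suc k + i) = ((-1) ^ (k + j) :: int)"
      using Suc by simp_all
    have "coeff (odd_fib_poly (Suc (Suc k))) j = coeff (odd_fib_poly (Suc k)) i
        - 2 * coeff (odd_fib_poly (Suc k)) j - coeff (odd_fib_poly k) j"
      using Suc by simp
    then show ?thesis
      unfolding 3 sgn of_nat_add of_nat_mult even odd by (simp add: algebra_simps)
  qed
qed

text \<open>Absorption gives \<open>(2 * j + 1) * ?c = (2 * k + 1) * (k + j choose (2 * j))\<close>,
  and the prime cannot divide the smaller positive number \<open>2 * j + 1\<close>.\<close>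

lemma prime_dvd_coeff_odd_fib_poly:
  assumes "prime (2 * k + 1)" "j < k"
  shows "int (2 * k + 1) dvd coeff (odd_fib_poly k) j"
proof -
  let ?c = "(k + j choose (2 * j)) + 2 * (k + j choose (2 * j + 1))"
  \<comment> \<open>Both sides equal \<open>(k + j) * (k + j - 1 choose (2 * j))\<close>.\<close>
  have "(2 * j + 1) * (k + j choose (2 * j + 1)) = (k - j) * (k + j choose (2 * j))"
    using binomial_absorb_comp[of "k + j" "2 * j"] binomial_absorption[of "2 * j" "k + j"] assms(2)
    by simp
  then have "(2 * j + 1) * ?c = (2 * j + 1 + 2 * (k - j)) * (k + j choose (2 * j))"
    by (simp only: distrib_left distrib_right mult.left_commute[of _ 2] mult.assoc)
  also have "2 * j + 1 + 2 * (k - j) = 2 * k + 1" using assms(2) by simp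
  finally have "2 * k + 1 dvd (2 * j + 1) * ?c" by (metis dvd_triv_left)
  moreover have "\<not> 2 * k + 1 dvd 2 * j + 1" using assms(2) by (auto dest: dvd_imp_le)
  ultimately have "2 * k + 1 dvd ?c" using assms(1) prime_dvd_multD by blast
  then show ?thesis unfolding coeff_odd_fib_poly by (metis dvd_mult int_dvd_int_iff)
qed

lemma degree_odd_fib_poly: "degree (odd_fib_poly k) = k"
proof (rule antisym)
  show "degree (odd_fib_poly k) \<le> k"
    by (rule degree_le) (simp add: coeff_odd_fib_poly binomial_eq_0)
  show "k \<le> degree (odd_fib_poly k)"
    by (rule le_degree) (simp add: coeff_odd_fib_poly flip: mult_2)
qed

section \<open>Eisenstein's criterion\<close>

lemma ex_first_nonmultiple_coeff:
  fixes q :: "'a :: idom poly"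
  assumes "\<not> P dvd lead_coeff q"
  obtains i where "i \<le> degree q" "\<not> P dvd coeff q i" "\<And>j. j < i \<Longrightarrow> P dvd coeff q j"
proof -
  let ?Q = "\<lambda>i. \<not> P dvd coeff q i"
  show ?thesis
    using that[of "LEAST i. ?Q i"] assms LeastI[of ?Q] Least_le[of ?Q] not_less_Least[of _ ?Q]
    by blast
qed

text \<open>If \<open>i\<close> and \<open>j\<close> are the first indices at which \<open>q\<close>
  and \<open>r\<close> have a coefficient outside the ideal of \<open>P\<close>, then coefficient
  \<open>i + j\<close> of the product is outside it too. Hence \<open>i + j\<close> reaches the
  degree of \<open>f\<close>, both indices are positive, and P^2 divides the constant term.\<close>

lemma eisenstein_irreducible\<^sub>d:
  fixes f :: "'a :: idom poly"
  assumes P: "prime_elem P" and deg: "degree f > 0" and lead: "\<not> P dvd lead_coeff f"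
    and coeffs: "\<And>j. j < degree f \<Longrightarrow> P dvd coeff f j" and const: "\<not> P\<^sup>2 dvd coeff f 0"
  shows "irreducible\<^sub>d f"
proof (rule irreducible\<^sub>dI)
  fix q r assume d: "degree q > 0" "degree q < degree f" "degree r > 0" "degree r < degree f"
    and f: "f = q * r"
  have lf: "lead_coeff f = lead_coeff q * lead_coeff r" by (simp only: f lead_coeff_mult)
  have df: "degree f = degree q + degree r"
    unfolding f using d by (intro degree_mult_eq) auto
  obtain i where i: "i \<le> degree q" "\<not> P dvd coeff q i" "\<And>j. j < i \<Longrightarrow> P dvd coeff q j"
    using ex_first_nonmultiple_coeff[of P q] lead lf by (metis dvd_mult2)
  obtain j where j: "j \<le> degree r" "\<not> P dvd coeff r j" "\<And>l. l < j \<Longrightarrow> P dvd coeff r l"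
    using ex_first_nonmultiple_coeff[of P r] lead lf by (metis dvd_mult)
  have "coeff f (i + j) = (\<Sum>l\<le>i + j. coeff q l * coeff r (i + j - l))"
    unfolding f coeff_mult ..
  also have "\<dots> = coeff q i * coeff r j + (\<Sum>l\<in>{..i + j} - {i}. coeff q l * coeff r (i + j - l))"
    by (subst sum.remove[of _ i]) auto
  finally have c: "coeff f (i + j) = \<dots>" .
  have "P dvd (\<Sum>l\<in>{..i + j} - {i}. coeff q l * coeff r (i + j - l))"
  proof (rule dvd_sum)
    fix l assume "l \<in> {..i + j} - {i}"
    then have "l < i \<or> i + j - l < j" by auto
    then show "P dvd coeff q l * coeff r (i + j - l)" using i(3) j(3) by auto
  qed
  moreover have "\<not> P dvd coeff q i * coeff r j"
    using P i(2) j(2) by (simp add: prime_elem_dvd_mult_iff)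
  ultimately have "\<not> P dvd coeff f (i + j)" unfolding c by (simp add: dvd_add_left_iff)
  then have "\<not> i + j < degree f" using coeffs by blast
  then have "i > 0" "j > 0" using i(1) j(1) d df by auto
  then have "P * P dvd coeff q 0 * coeff r 0" using i(3) j(3) by (intro mult_dvd_mono) auto
  then show False using const by (simp add: f coeff_mult_0 power2_eq_square)
qed (use deg in simp)

lemma irreducible_odd_fib_poly:
  assumes "prime (2 * k + 1)"
  shows "irreducible (map_poly rat_of_int (odd_fib_poly k))"
proof -
  let ?p = "int (2 * k + 1)"
  have k: "k > 0" using assms by (cases k) auto
  have p: "prime ?p" using assms by (simp only: prime_nat_int_transfer)
  have lead: "lead_coeff (odd_fib_poly k) = 1"
    by (simp add: degree_odd_fib_poly coeff_odd_fib_poly flip: mult_2)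
  have "coeff (odd_fib_poly k) 0 = (-1) ^ k * ?p" by (simp add: coeff_odd_fib_poly)
  \<comment> \<open>The factor \<open>1\<close> puts the claim in a form where cancellation reduces
    it to \<open>?p dvd 1\<close>.\<close>
  then have "?p\<^sup>2 dvd coeff (odd_fib_poly k) 0 \<longleftrightarrow> ?p * ?p dvd ?p * 1"
    by (simp add: power2_eq_square minus_one_power_iff)
  then have const: "\<not> ?p\<^sup>2 dvd coeff (odd_fib_poly k) 0"
    using k by (simp only: dvd_mult_cancel_left) auto
  have "irreducible\<^sub>d (odd_fib_poly k)"
  proof (rule eisenstein_irreducible\<^sub>d[of ?p])
    show "\<not> ?p dvd lead_coeff (odd_fib_poly k)" unfolding lead using k by simp
    show "?p dvd coeff (odd_fib_poly k) j" if "j < degree (odd_fib_poly k)" for j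
      using prime_dvd_coeff_odd_fib_poly[OF assms] that by (simp only: degree_odd_fib_poly)
  qed (use k p const in \<open>auto simp: degree_odd_fib_poly\<close>)
  then show ?thesis using irreducible\<^sub>d_int_rat irreducible_connect_field by blast
qed

section \<open>Binet's formula and the location of the roots\<close>

lemma poly_fibonacci_type_complex:
  fixes \<alpha> \<beta> :: complex
  assumes "\<alpha> * \<beta> = -1"
  shows "(\<alpha> - \<beta>) * poly (map_poly of_int (fibonacci_type_poly [:0, 1:] 1 n)) (\<alpha> + \<beta>) = \<alpha> ^ n - \<beta> ^ n"
proof (induction n rule: fibonacci_type_poly.induct[where P = "\<lambda>_ _ n. _ n"])
  case (3 d g n)
  \<comment> \<open>Both \<alpha> and \<beta> are roots of t^2 = (\<alpha> + \<beta>) t + 1, so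
    their powers obey the recurrence. Multiplying by \<alpha> - \<beta> instead of dividing covers
    the case \<alpha> = \<beta>.\<close>
  have "\<alpha> ^ n * (\<alpha> * \<beta>) = - (\<alpha> ^ n)" "\<beta> ^ n * (\<alpha> * \<beta>) = - (\<beta> ^ n)"
    using assms by auto
  then have *: "\<alpha> ^ Suc (Suc n) - \<beta> ^ Suc (Suc n)
      = (\<alpha> + \<beta>) * (\<alpha> ^ Suc n - \<beta> ^ Suc n) + (\<alpha> ^ n - \<beta> ^ n)"
    by (simp add: algebra_simps)
  show ?case
    unfolding * 3[symmetric] by (simp add: hom_distribs algebra_simps)
qed auto

lemma fibonacci_type_root_imaginary:
  fixes z :: complex
  assumes "poly (map_poly of_int (fibonacci_type_poly [:0, 1:] 1 n)) z = 0" "n > 0"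
  shows "cnj z = - z"
proof -
  \<comment> \<open>The roots of t^2 - z t - 1, with sum \<open>z\<close> and product -1.\<close>
  define \<alpha> where "\<alpha> = (z + csqrt (z\<^sup>2 + 4)) / 2"
  define \<beta> where "\<beta> = (z - csqrt (z\<^sup>2 + 4)) / 2"
  have z: "z = \<alpha> + \<beta>" by (simp add: \<alpha>_def \<beta>_def field_simps)
  have "\<alpha> * \<beta> = (z\<^sup>2 - (csqrt (z\<^sup>2 + 4))\<^sup>2) / 4"
    by (simp add: \<alpha>_def \<beta>_def field_simps power2_eq_square)
  then have ab: "\<alpha> * \<beta> = -1" by simp
  from poly_fibonacci_type_complex[OF this, of n] assms(1) have "\<alpha> ^ n = \<beta> ^ n"
    by (simp add: z)
  then have "norm \<alpha> = norm \<beta>"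
    using assms(2) by (metis norm_ge_zero norm_power power_eq_imp_eq_base)
  moreover have "norm \<alpha> * norm \<beta> = 1" using ab by (simp flip: norm_mult)
  ultimately have "norm \<alpha> = 1" using abs_square_eq_1[of "norm \<alpha>"]
    by (simp add: power2_eq_square)
  \<comment> \<open>On the unit circle the conjugate of \<alpha> is its inverse, which is
    -\<beta>.\<close>
  then have "\<alpha> * cnj \<alpha> = 1" by (simp add: complex_norm_square[symmetric])
  with ab have "\<alpha> * (cnj \<alpha> + \<beta>) = 0" by (simp add: distrib_left)
  moreover have "\<alpha> \<noteq> 0" using ab by auto
  ultimately have *: "cnj \<alpha> = - \<beta>" by (simp add: eq_neg_iff_add_eq_0)
  then have "cnj \<beta> = - \<alpha>" by (metis complex_cnj_cnj complex_cnj_minus minus_minus)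
  with * show ?thesis by (simp add: z)
qed

section \<open>Even polynomials and substitutions\<close>

lemma even_poly_eq_pcompose:
  fixes u :: "'a :: {idom, ring_char_0} poly"
  assumes "u \<circ>\<^sub>p [:0, -1:] = u"
  obtains w where "u = w \<circ>\<^sub>p [:c, 0, 1:]"
proof
  \<comment> \<open>Expands the even part of \<open>u\<close> with x^2 written as y - c; indices
    beyond half the degree only add zero terms.\<close>
  define w where "w = (\<Sum>i\<le>degree u. smult (coeff u (2 * i)) ([:-c, 1:] ^ i))"
  have "w \<circ>\<^sub>p [:c, 0, 1:] = (\<Sum>i\<le>degree u. smult (coeff u (2 * i)) ([:0, 0, 1:] ^ i))"
    by (simp add: w_def pcompose_sum pcompose_smult pcompose_hom.hom_power pcompose_pCons)
  also have "[:0, 0, 1:] = (monom 1 2 :: 'a poly)"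
    by (simp add: eval_nat_numeral monom_Suc)
  finally have w: "w \<circ>\<^sub>p [:c, 0, 1:] = (\<Sum>i\<le>degree u. monom (coeff u (2 * i)) (2 * i))"
    by (simp add: monom_power smult_monom mult.commute)
  show "u = w \<circ>\<^sub>p [:c, 0, 1:]"
  proof (rule poly_eqI)
    fix n
    show "coeff u n = coeff (w \<circ>\<^sub>p [:c, 0, 1:]) n"
    proof (cases "even n")
      case True
      then obtain m where m: "n = 2 * m" by blast
      have "coeff (w \<circ>\<^sub>p [:c, 0, 1:]) n = (\<Sum>i\<le>degree u. if i = m then coeff u n else 0)"
        unfolding w m by (auto simp: coeff_sum intro!: sum.cong)
      also have "\<dots> = coeff u n"
        unfolding m by (subst sum.delta) (auto simp: coeff_eq_0)
      finally show ?thesis ..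
    next
      case False
      have "coeff u n = coeff (u \<circ>\<^sub>p [:0, -1:]) n" by (simp only: assms)
      then have "coeff u n = - coeff u n"
        using False by (simp add: coeff_pcompose_linear)
      moreover have "coeff (w \<circ>\<^sub>p [:c, 0, 1:]) n = 0"
        using False unfolding w by (auto simp: coeff_sum intro!: sum.neutral)
      ultimately show ?thesis by simp
    qed
  qed
qed

text \<open>The inverse substitution (x - b) / a carries factorizations back and preserves degrees,
  hence units.\<close>

lemma irreducible_pcompose_linear:
  fixes f :: "'a :: field poly"
  assumes "irreducible f" "a \<noteq> 0"
  shows "irreducible (f \<circ>\<^sub>p [:b, a:])"
proof -
  have inv: "[:- b / a, 1 / a:] \<circ>\<^sub>p [:b, a:] = [:0, 1:]" "[:b, a:] \<circ>\<^sub>p [:- b / a, 1 / a:] = [:0, 1:]"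
    using assms(2) by (simp_all add: pcompose_pCons)
  show ?thesis
  proof (rule irreducibleI)
    show "f \<circ>\<^sub>p [:b, a:] \<noteq> 0" using assms by (simp add: pcompose_eq_0_iff irreducible_def)
    show "\<not> f \<circ>\<^sub>p [:b, a:] dvd 1"
      using irreducible_not_unit[OF assms(1)] assms irreducible_def[of f]
      by (auto simp: poly_dvd_1 degree_pcompose)
    fix u v assume "f \<circ>\<^sub>p [:b, a:] = u * v"
    then have "f \<circ>\<^sub>p [:b, a:] \<circ>\<^sub>p [:- b / a, 1 / a:] = (u * v) \<circ>\<^sub>p [:- b / a, 1 / a:]" by simp
    then have "f = (u \<circ>\<^sub>p [:- b / a, 1 / a:]) * (v \<circ>\<^sub>p [:- b / a, 1 / a:])"
      by (simp only: pcompose_mult pcompose_idR inv flip: pcompose_assoc)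
    then have "u \<circ>\<^sub>p [:- b / a, 1 / a:] dvd 1 \<or> v \<circ>\<^sub>p [:- b / a, 1 / a:] dvd 1"
      using irreducibleD[OF assms(1)] by blast
    moreover have "w dvd 1" if "w \<circ>\<^sub>p [:- b / a, 1 / a:] dvd 1" for w
      using that assms(2) by (auto simp: poly_dvd_1 degree_pcompose pcompose_pCons elim: degree_eq_zeroE)
    ultimately show "u dvd 1 \<or> v dvd 1" by blast
  qed
qed

interpretation of_rat_poly_hom: map_poly_comm_semiring_hom "of_rat :: rat \<Rightarrow> complex" ..

text \<open>A common complex root rules out a Bezout identity between \<open>u\<close> and u(-x), so
  \<open>u\<close> divides u(-x); equal degrees make the quotient constant.\<close>

lemma irreducible_imaginary_roots_even:
  fixes u :: "rat poly"
  assumes u: "irreducible u" and u0: "poly u 0 \<noteq> 0"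
    and roots: "\<And>z :: complex. poly (map_poly of_rat u) z = 0 \<Longrightarrow> cnj z = - z"
  shows "u \<circ>\<^sub>p [:0, -1:] = u"
proof -
  let ?u' = "u \<circ>\<^sub>p [:0, -1:]" and ?C = "map_poly of_rat :: rat poly \<Rightarrow> complex poly"
  have degu: "degree u > 0" using u irreducible_connect_field[of u] by auto
  then have "degree (?C u) > 0" by simp
  then have "\<not> constant (poly (?C u))" by (simp add: constant_degree)
  then obtain z where z: "poly (?C u) z = 0" using fundamental_theorem_of_algebra by blast
  have "poly (?C ?u') z = poly (?C u) (- z)"
    by (simp add: of_rat_hom.map_poly_pcompose poly_pcompose)
  also have "\<dots> = poly (?C u) (cnj z)" using roots[OF z] by simp
  also have "\<dots> = cnj (poly (?C u) z)"
  proof -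
    have "map_poly cnj (?C u) = ?C u"
    proof (rule poly_eqI)
      show "coeff (map_poly cnj (?C u)) n = coeff (?C u) n" for n
        by (cases "coeff u n") (simp add: coeff_map_poly of_rat_rat)
    qed
    then show ?thesis by (simp add: poly_cnj)
  qed
  finally have z': "poly (?C ?u') z = 0" using z by simp
  have "u dvd ?u'"
  proof (rule ccontr)
    assume "\<not> u dvd ?u'"
    then have "coprime u ?u'"
      using u by (simp add: prime_elem_imp_coprime prime_elem_iff_irreducible)
    then obtain s t where "s * u + t * ?u' = 1"
      using bezout_coefficients_fst_snd[of u ?u'] by auto
    then have "?C s * ?C u + ?C t * ?C ?u' = 1"
      by (metis of_rat_poly_hom.hom_add of_rat_poly_hom.hom_mult of_rat_poly_hom.hom_one)
    then have "poly (?C s * ?C u + ?C t * ?C ?u') z = 1" by simp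
    then show False using z z' by simp
  qed
  then obtain c where c: "?u' = u * c" by blast
  have deg': "degree ?u' = degree u" by (simp add: degree_pcompose)
  then have "c \<noteq> 0" using c degu by auto
  moreover have "u \<noteq> 0" using degu by auto
  ultimately have "degree c = 0" using deg' c degree_mult_eq[of u c] by simp
  then obtain k where k: "c = [:k:]" by (auto elim: degree_eq_zeroE)
  \<comment> \<open>Comparing the nonzero values at 0 excludes the quotient -1, which an odd
    \<open>u\<close> would give.\<close>
  have "poly ?u' 0 = poly u 0" by (simp add: poly_pcompose)
  then have "k = 1" using c k u0 by simp
  then show ?thesis using c k by simp
qed

lemma irreducible_pcompose_square:
  fixes f :: "rat poly"
  assumes f: "irreducible f" and f0: "poly (f \<circ>\<^sub>p [:c, 0, 1:]) 0 \<noteq> 0"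
    and roots: "\<And>z :: complex. poly (map_poly of_rat (f \<circ>\<^sub>p [:c, 0, 1:])) z = 0 \<Longrightarrow> cnj z = - z"
  shows "irreducible (f \<circ>\<^sub>p [:c, 0, 1:])"
proof -
  let ?q = "[:c, 0, 1:]" and ?s = "[:0, -1:] :: rat poly"
  have degf: "degree f > 0" using f irreducible_connect_field[of f] by auto
  have nz: "f \<circ>\<^sub>p ?q \<noteq> 0" using f0 by auto
  have "\<not> is_unit (f \<circ>\<^sub>p ?q)" using degf by (simp add: poly_dvd_1 degree_pcompose)
  then obtain u where u: "prime u" "u dvd f \<circ>\<^sub>p ?q"
    using prime_divisor_exists[OF nz] by blast
  then obtain v where v: "f \<circ>\<^sub>p ?q = u * v" by blast
  have irr: "irreducible u" using u(1) by (intro prime_elem_imp_irreducible prime_imp_prime_elem)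
  have even_u: "u \<circ>\<^sub>p ?s = u"
  proof (rule irreducible_imaginary_roots_even[OF irr])
    show "poly u 0 \<noteq> 0" using f0 v by auto
    show "cnj z = - z" if "poly (map_poly of_rat u) z = 0" for z :: complex
    proof (rule roots)
      show "poly (map_poly of_rat (f \<circ>\<^sub>p ?q)) z = 0"
        unfolding v using that by (simp add: of_rat_poly_hom.hom_mult)
    qed
  qed
  \<comment> \<open>The product and \<open>u\<close> are even, so cancelling \<open>u\<close> shows
    that the cofactor is even as well.\<close>
  have "u * (v \<circ>\<^sub>p ?s) = (u * v) \<circ>\<^sub>p ?s" by (simp add: pcompose_mult even_u)
  also have "\<dots> = f \<circ>\<^sub>p (?q \<circ>\<^sub>p ?s)" by (simp add: v[symmetric] pcompose_assoc)
  also have "?q \<circ>\<^sub>p ?s = ?q" by (simp add: pcompose_pCons)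
  finally have "u * (v \<circ>\<^sub>p ?s) = u * v" by (simp only: v)
  then have even_v: "v \<circ>\<^sub>p ?s = v" using irr by auto
  obtain w where w: "u = w \<circ>\<^sub>p ?q" using even_poly_eq_pcompose[OF even_u] .
  obtain w' where w': "v = w' \<circ>\<^sub>p ?q" using even_poly_eq_pcompose[OF even_v] .
  \<comment> \<open>Composition with the nonconstant \<open>?q\<close> is injective, so the
    factorization descends to \<open>f\<close>.\<close>
  have "(f - w * w') \<circ>\<^sub>p ?q = 0" by (simp only: pcompose_diff pcompose_mult v diff_self flip: w w')
  then have "f = w * w'" by (simp add: pcompose_eq_0_iff)
  then have "w dvd 1 \<or> w' dvd 1" using f irreducibleD by blast
  moreover have "\<not> w dvd 1"
  proof
    assume "w dvd 1"
    then have "degree u = 0" by (simp add: w degree_pcompose poly_dvd_1)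
    then show False using irr irreducible_connect_field[of u] by auto
  qed
  ultimately have "v dvd 1" unfolding w' by (auto simp: poly_dvd_1 elim: degree_eq_zeroE)
  then show ?thesis unfolding v using irr by (metis irreducible_mult_unit_left mult.commute)
qed

theorem proposition3p4:
  fixes a b :: int and d g :: "int poly" and p :: nat
  assumes "a \<noteq> 0"
    and "d = [:b, a:]"
    and "g = 1"
    and "prime p"
  shows "irreducible (map_poly rat_of_int (fibonacci_type_poly d g p))"
proof (cases "p = 2")
  case True
  then have "fibonacci_type_poly d g p = d" by (simp add: eval_nat_numeral)
  then show ?thesis
    using assms(1) by (simp add: assms(2) irreducible_linear_field_poly map_poly_pCons)
next
  case False
  then obtain k where k: "p = 2 * k + 1"
    using prime_odd_nat[OF assms(4)] prime_ge_2_nat[OF assms(4)] by (metis le_neq_implies_less oddE)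
  let ?R = "map_poly rat_of_int" and ?f = "odd_fib_poly k"
  \<comment> \<open>Stated for all coefficients: it serves both for d = x, where the roots are
    studied, and for the given \<open>d\<close>.\<close>
  have F: "?R (fibonacci_type_poly [:b', a':] 1 p) = ?R ?f \<circ>\<^sub>p [:4, 0, 1:] \<circ>\<^sub>p [:of_int b', of_int a':]"
    for a' b'
  proof -
    have "?R ([:b', a':]\<^sup>2 + [:4:]) = [:4, 0, 1:] \<circ>\<^sub>p [:of_int b', of_int a':]"
      by (rule poly_eqI)
        (simp add: power2_eq_square pcompose_pCons coeff_map_poly coeff_pCons split: nat.splits)
    then show ?thesis
      unfolding k fibonacci_type_poly_odd of_int_hom.map_poly_pcompose by (simp only: pcompose_assoc)
  qed
  have F1: "?R (fibonacci_type_poly [:0, 1:] 1 p) = ?R ?f \<circ>\<^sub>p [:4, 0, 1:]"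
    using F[of 0 1] by (simp only: of_int_0 of_int_1 pcompose_idR)
  have "irreducible (?R ?f \<circ>\<^sub>p [:4, 0, 1:])"
  proof (rule irreducible_pcompose_square)
    show "irreducible (?R ?f)" using irreducible_odd_fib_poly assms(4) k by simp
    \<comment> \<open>At x = 0 the recurrence reads F(n+2) = F(n), so every odd-index term has the
      value F(1) = 1.\<close>
    have "poly (fibonacci_type_poly [:0, 1:] 1 (2 * k + 1)) 0 = 1"
      by (induction k) auto
    then have "poly (?R (fibonacci_type_poly [:0, 1:] 1 p)) 0 = 1"
      by (metis k of_int_0 of_int_1 of_int_hom.poly_map_poly)
    then show "poly (?R ?f \<circ>\<^sub>p [:4, 0, 1:]) 0 \<noteq> 0" unfolding F1 by simp
    fix z :: complex
    assume "poly (map_poly of_rat (?R ?f \<circ>\<^sub>p [:4, 0, 1:])) z = 0"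
    then have "poly (map_poly of_int (fibonacci_type_poly [:0, 1:] 1 p)) z = 0"
      unfolding F1[symmetric] by (simp add: map_poly_map_poly o_def)
    then show "cnj z = - z" using fibonacci_type_root_imaginary k by simp
  qed
  then show ?thesis
    unfolding assms(2,3) F using assms(1) by (intro irreducible_pcompose_linear) simp_all
qed

end
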